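(* The enveloping distance from the class $\mathrm{(pfd)}$ of pointwise finite-dimensional persistence modules to the class $\mathrm{(qtame)}$ of q-tame persistence modules is zero: $E(\mathrm{(pfd)},\mathrm{(qtame)})=0$.
   Context: Fix a field $\mathbf{k}$. A persistence module is a functor $M:(\mathbb{R},\le)\to \mathrm{Vect}_{\mathbf{k}}$. For $\varepsilon\ge 0$, $M,N$ are $\varepsilon$-interleaved if there are families of linear maps $\varphi_a:M(a)\to N(a+\varepsilon)$ and $\psi_a:N(a)\to M(a+\varepsilon)$, natural in $a\in\mathbb{R}$, with $\psi_{a+\varepsilon}\varphi_a=M(a\le a+2\varepsilon)$ and $\varphi_{a+\varepsilon}\psi_a=N(a\le a+2\varepsilon)$ for all $a$. $M$ is pointwise finite dimensional if every $M(a)$ is finite dimensional; $M$ is q-tame if $M(a<b)$ has finite rank for all $a<b$. For classes $\mathcal{A},\mathcal{B}$ of persistence modules, $E(\mathcal{A},\mathcal{B})=\inf\{r\ge 0 : \forall B\in\mathcal{B}\ \forall s>r\ \exists A\in\mathcal{A} \text{ such that } A,B \text{ are } s\text{-interleaved}\}$. *)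

theory Defs
  imports "HOL-Algebra.Module" "HOL-Library.Extended_Real"
begin

text \<open>
  Vector spaces over \<open>K\<close> are modules in the sense of \<^locale>\<open>Module.module\<close>, with \<open>K\<close> assumed to be a
  \<^locale>\<open>field\<close> where it matters. All vector spaces under consideration have carriers in one type
  \<open>'v\<close>, which plays the role of the universe underlying \<open>Vect\<^sub>K\<close>: the carrier sets and the
  operations on them are otherwise unrelated, and in particular may be different at every index of
  a persistence module. Maps are total functions on \<open>'v\<close>, of which only the restriction to the
  carrier of the source is meaningful.
\<close>

definition linear_maps ::
  "('k, 'r) ring_scheme \<Rightarrow> ('k, 'v, 'm) module_scheme \<Rightarrow> ('k, 'w, 'n) module_scheme \<Rightarrow> ('v \<Rightarrow> 'w) set"
  where
  "linear_maps K V W = {f. f \<in> carrier V \<rightarrow> carrier W \<and>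
     (\<forall>x \<in> carrier V. \<forall>y \<in> carrier V. f (x \<oplus>\<^bsub>V\<^esub> y) = f x \<oplus>\<^bsub>W\<^esub> f y) \<and>
     (\<forall>c \<in> carrier K. \<forall>x \<in> carrier V. f (c \<odot>\<^bsub>V\<^esub> x) = c \<odot>\<^bsub>W\<^esub> f x)}"

definition finite_basis ::
  "('k, 'r) ring_scheme \<Rightarrow> ('k, 'v, 'm) module_scheme \<Rightarrow> 'v set \<Rightarrow> bool" where
  "finite_basis K V B \<longleftrightarrow> finite B \<and> B \<subseteq> carrier V \<and>
     (\<forall>v \<in> carrier V. \<exists>c \<in> B \<rightarrow> carrier K. v = (\<Oplus>\<^bsub>V\<^esub>b \<in> B. c b \<odot>\<^bsub>V\<^esub> b)) \<and>
     (\<forall>c \<in> B \<rightarrow> carrier K. (\<Oplus>\<^bsub>V\<^esub>b \<in> B. c b \<odot>\<^bsub>V\<^esub> b) = \<zero>\<^bsub>V\<^esub> \<longrightarrow> (\<forall>b \<in> B. c b = \<zero>\<^bsub>K\<^esub>))"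

definition finite_dimensional ::
  "('k, 'r) ring_scheme \<Rightarrow> ('k, 'v, 'm) module_scheme \<Rightarrow> bool" where
  "finite_dimensional K V \<longleftrightarrow> (\<exists>B. finite_basis K V B)"

definition finite_rank ::
  "('k, 'r) ring_scheme \<Rightarrow> ('k, 'v, 'm) module_scheme \<Rightarrow> ('k, 'w, 'n) module_scheme \<Rightarrow> ('v \<Rightarrow> 'w) \<Rightarrow> bool"
  where
  "finite_rank K V W f \<longleftrightarrow> finite_dimensional K (W\<lparr>carrier := f ` carrier V\<rparr>)"

text \<open>
  \<open>mor M a b\<close> is the structure map \<open>M(a \<le> b)\<close>; it is constrained and used only for \<open>a \<le> b\<close>.
\<close>

record ('k, 'v) persistence_data =
  obj :: "real \<Rightarrow> ('k, 'v) module"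
  mor :: "real \<Rightarrow> real \<Rightarrow> 'v \<Rightarrow> 'v"

definition persistence_module :: "('k, 'r) ring_scheme \<Rightarrow> ('k, 'v) persistence_data \<Rightarrow> bool" where
  "persistence_module K M \<longleftrightarrow>
     (\<forall>a. Module.module K (obj M a)) \<and>
     (\<forall>a b. a \<le> b \<longrightarrow> mor M a b \<in> linear_maps K (obj M a) (obj M b)) \<and>
     (\<forall>a. \<forall>x \<in> carrier (obj M a). mor M a a x = x) \<and>
     (\<forall>a b c. a \<le> b \<longrightarrow> b \<le> c \<longrightarrow>
        (\<forall>x \<in> carrier (obj M a). mor M b c (mor M a b x) = mor M a c x))"

definition shift_morphism ::
  "('k, 'r) ring_scheme \<Rightarrow> real \<Rightarrow> ('k, 'v) persistence_data \<Rightarrow> ('k, 'v) persistence_data \<Rightarrow>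
   (real \<Rightarrow> 'v \<Rightarrow> 'v) \<Rightarrow> bool" where
  "shift_morphism K \<epsilon> M N \<phi> \<longleftrightarrow>
     (\<forall>a. \<phi> a \<in> linear_maps K (obj M a) (obj N (a + \<epsilon>))) \<and>
     (\<forall>a b. a \<le> b \<longrightarrow> (\<forall>x \<in> carrier (obj M a).
        \<phi> b (mor M a b x) = mor N (a + \<epsilon>) (b + \<epsilon>) (\<phi> a x)))"

definition interleaved ::
  "('k, 'r) ring_scheme \<Rightarrow> real \<Rightarrow> ('k, 'v) persistence_data \<Rightarrow> ('k, 'v) persistence_data \<Rightarrow> bool"
  where
  "interleaved K \<epsilon> M N \<longleftrightarrow> 0 \<le> \<epsilon> \<and>
     (\<exists>\<phi> \<psi>. shift_morphism K \<epsilon> M N \<phi> \<and> shift_morphism K \<epsilon> N M \<psi> \<and>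
        (\<forall>a. \<forall>x \<in> carrier (obj M a). \<psi> (a + \<epsilon>) (\<phi> a x) = mor M a (a + 2 * \<epsilon>) x) \<and>
        (\<forall>a. \<forall>x \<in> carrier (obj N a). \<phi> (a + \<epsilon>) (\<psi> a x) = mor N a (a + 2 * \<epsilon>) x))"

definition pfd :: "('k, 'r) ring_scheme \<Rightarrow> ('k, 'v) persistence_data set" where
  "pfd K = {M. persistence_module K M \<and> (\<forall>a. finite_dimensional K (obj M a))}"

definition qtame :: "('k, 'r) ring_scheme \<Rightarrow> ('k, 'v) persistence_data set" where
  "qtame K = {M. persistence_module K M \<and>
     (\<forall>a b. a < b \<longrightarrow> finite_rank K (obj M a) (obj M b) (mor M a b))}"

text \<open>
  The infimum is taken in the extended reals, so that it is \<open>\<infinity>\<close> when no \<open>r\<close> is admissible.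
\<close>

definition enveloping_distance ::
  "('k, 'r) ring_scheme \<Rightarrow> ('k, 'v) persistence_data set \<Rightarrow> ('k, 'v) persistence_data set \<Rightarrow> ereal"
  where
  "enveloping_distance K \<A> \<B> =
     Inf (ereal ` {r. 0 \<le> r \<and> (\<forall>B \<in> \<B>. \<forall>s > r. \<exists>A \<in> \<A>. interleaved K s A B)})"

end

theory Submission
  imports Defs
begin

text \<open>
  Given a q-tame module \<open>N\<close> and \<open>s > 0\<close>, replace each space \<open>N(a)\<close> by the part of it that is
  already born at \<open>a - s\<close>, that is, by the image of \<open>N(a - s \<le> a)\<close>. Functoriality makes these
  images a submodule of \<open>N\<close>, and q-tameness says precisely that each of them is finite dimensional
  (\<open>past_image_in_pfd\<close>). The submodule is \<open>s\<close>-interleaved with \<open>N\<close>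
  (\<open>interleaved_past_image\<close>): an element of \<open>N(a)\<close>, pushed forward by \<open>s\<close>, is by definition in the
  submodule, so the structure maps \<open>N(a \<le> a + s)\<close> serve as interleaving maps in both directions.
  Since \<open>s > 0\<close> is arbitrary, \<open>r = 0\<close> is admissible in the infimum defining the enveloping distance.
\<close>

text \<open>
  Zeros and negatives in the image come from scalar multiplication by \<open>\<zero>\<close> and \<open>\<ominus> \<one>\<close>, with which a
  linear map commutes by definition.
\<close>

lemma linear_image_submodule:
  assumes V: "Module.module K V" and W: "Module.module K W" and f: "f \<in> linear_maps K V W"
  shows "submodule (f ` carrier V) K W"
proof -
  interpret V: Module.module K V by (rule V)
  interpret W: Module.module K W by (rule W)
  have closed: "f x \<in> carrier W" if "x \<in> carrier V" for x
    using f that unfolding linear_maps_def by blast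
  have add: "f (x \<oplus>\<^bsub>V\<^esub> y) = f x \<oplus>\<^bsub>W\<^esub> f y" if "x \<in> carrier V" "y \<in> carrier V" for x y
    using f that unfolding linear_maps_def by blast
  have smult: "f (c \<odot>\<^bsub>V\<^esub> x) = c \<odot>\<^bsub>W\<^esub> f x" if "c \<in> carrier K" "x \<in> carrier V" for c x
    using f that unfolding linear_maps_def by blast
  show ?thesis
  proof (rule W.submoduleI)
    show "f ` carrier V \<subseteq> carrier W"
      using closed by blast
    have "\<zero>\<^bsub>W\<^esub> = f (\<zero>\<^bsub>K\<^esub> \<odot>\<^bsub>V\<^esub> \<zero>\<^bsub>V\<^esub>)"
      by (subst smult) (simp_all add: closed)
    then show "\<zero>\<^bsub>W\<^esub> \<in> f ` carrier V"
      by blast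
  next
    fix w assume "w \<in> f ` carrier V"
    then obtain x where x: "x \<in> carrier V" "w = f x" by blast
    have "\<ominus>\<^bsub>W\<^esub> w = f ((\<ominus>\<^bsub>K\<^esub> \<one>\<^bsub>K\<^esub>) \<odot>\<^bsub>V\<^esub> x)"
      by (subst smult) (simp_all add: x closed W.smult_l_minus)
    then show "\<ominus>\<^bsub>W\<^esub> w \<in> f ` carrier V"
      using x by blast
  next
    fix v w assume "v \<in> f ` carrier V" "w \<in> f ` carrier V"
    then show "v \<oplus>\<^bsub>W\<^esub> w \<in> f ` carrier V"
      by (auto simp flip: add)
  next
    fix c w assume "c \<in> carrier K" "w \<in> f ` carrier V"
    then show "c \<odot>\<^bsub>W\<^esub> w \<in> f ` carrier V"
      by (auto simp flip: smult)
  qed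
qed

lemma linear_maps_restrict_carriers:
  assumes "f \<in> linear_maps K V W" and "A \<subseteq> carrier V" and "f ` A \<subseteq> B"
  shows "f \<in> linear_maps K (V\<lparr>carrier := A\<rparr>) (W\<lparr>carrier := B\<rparr>)"
  using assms unfolding linear_maps_def by (auto simp: subset_iff)

lemma mor_linear:
  "persistence_module K N \<Longrightarrow> a \<le> b \<Longrightarrow> mor N a b \<in> linear_maps K (obj N a) (obj N b)"
  unfolding persistence_module_def by blast

lemma mor_closed:
  "persistence_module K N \<Longrightarrow> a \<le> b \<Longrightarrow> x \<in> carrier (obj N a) \<Longrightarrow> mor N a b x \<in> carrier (obj N b)"
  using mor_linear unfolding linear_maps_def by blast

lemma mor_mor:
  "persistence_module K N \<Longrightarrow> a \<le> b \<Longrightarrow> b \<le> c \<Longrightarrow> x \<in> carrier (obj N a) \<Longrightarrow>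
    mor N b c (mor N a b x) = mor N a c x"
  unfolding persistence_module_def by blast

definition past_image :: "real \<Rightarrow> ('k, 'v) persistence_data \<Rightarrow> ('k, 'v) persistence_data" where
  "past_image s N =
     \<lparr>obj = (\<lambda>a. (obj N a)\<lparr>carrier := mor N (a - s) a ` carrier (obj N (a - s))\<rparr>), mor = mor N\<rparr>"

lemma past_image_subset:
  assumes "persistence_module K N" and "0 \<le> s"
  shows "mor N (a - s) a ` carrier (obj N (a - s)) \<subseteq> carrier (obj N a)"
  using mor_closed[OF assms(1)] assms(2) by auto

lemma past_image_carrier:
  assumes "persistence_module K N" and "0 \<le> s" and "x \<in> carrier (obj (past_image s N) a)"
  shows "x \<in> carrier (obj N a)"
  using past_image_subset[OF assms(1,2)] assms(3) by (auto simp: past_image_def)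

text \<open>
  An element \<open>N(a - s \<le> a) x\<close> is carried by \<open>N(a \<le> b)\<close> to the image under \<open>N(b - s \<le> b)\<close> of
  \<open>N(a - s \<le> b - s) x\<close>.
\<close>

lemma mor_past_image_subset:
  assumes N: "persistence_module K N" and "0 \<le> s" and "a \<le> b"
  shows "mor N a b ` mor N (a - s) a ` carrier (obj N (a - s))
    \<subseteq> mor N (b - s) b ` carrier (obj N (b - s))"
proof clarify
  fix x assume x: "x \<in> carrier (obj N (a - s))"
  have "mor N a b (mor N (a - s) a x) = mor N (b - s) b (mor N (a - s) (b - s) x)"
    using assms x by (simp add: mor_mor[OF N])
  then show "mor N a b (mor N (a - s) a x) \<in> mor N (b - s) b ` carrier (obj N (b - s))"
    using mor_closed[OF N _ x, of "b - s"] \<open>a \<le> b\<close> by simp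
qed

lemma persistence_module_past_image:
  assumes N: "persistence_module K N" and s: "0 \<le> s"
  shows "persistence_module K (past_image s N)"
proof -
  note sub = past_image_subset[OF N s]
  have module: "Module.module K (obj N a)" for a
    using N unfolding persistence_module_def by blast
  have "Module.module K (obj (past_image s N) a)" for a
    using submodule.submodule_is_module[OF linear_image_submodule[OF module module mor_linear[OF N]] module] s
    by (simp add: past_image_def)
  moreover have "mor N a b \<in> linear_maps K (obj (past_image s N) a) (obj (past_image s N) b)"
    if "a \<le> b" for a b
    using linear_maps_restrict_carriers[OF mor_linear[OF N that] sub mor_past_image_subset[OF N s that]]
    by (simp add: past_image_def)
  moreover have "mor N a a x = x" if "x \<in> carrier (obj (past_image s N) a)" for a x
    using N past_image_carrier[OF N s that] unfolding persistence_module_def by blast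
  moreover have "mor N b c (mor N a b x) = mor N a c x"
    if "a \<le> b" "b \<le> c" "x \<in> carrier (obj (past_image s N) a)" for a b c x
    using mor_mor[OF N that(1,2) past_image_carrier[OF N s that(3)]] .
  moreover have "mor (past_image s N) = mor N"
    by (simp add: past_image_def)
  ultimately show ?thesis
    unfolding persistence_module_def by simp
qed

lemma past_image_in_pfd:
  assumes "N \<in> qtame K" and "0 < s"
  shows "past_image s N \<in> pfd K"
proof -
  have "finite_rank K (obj N (a - s)) (obj N a) (mor N (a - s) a)" for a
    using assms unfolding qtame_def by simp
  then have "finite_dimensional K (obj (past_image s N) a)" for a
    by (simp add: finite_rank_def past_image_def)
  moreover have "persistence_module K (past_image s N)"
    using assms by (simp add: qtame_def persistence_module_past_image)
  ultimately show ?thesis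
    by (simp add: pfd_def)
qed

lemma interleaved_past_image:
  assumes N: "persistence_module K N" and s: "0 \<le> s"
  shows "interleaved K s (past_image s N) N"
proof -
  let ?M = "past_image s N"
  let ?\<phi> = "\<lambda>a. mor N a (a + s)"
  note sub = past_image_subset[OF N s]
  have linear: "?\<phi> a \<in> linear_maps K (obj N a) (obj N (a + s))" for a
    using mor_linear[OF N] s by simp
  note carrier = past_image_carrier[OF N s]
  have mor: "mor ?M = mor N"
    by (simp add: past_image_def)
  have natural: "?\<phi> b (mor N a b x) = mor N (a + s) (b + s) (?\<phi> a x)"
    if "a \<le> b" "x \<in> carrier (obj N a)" for a b x
    using that s by (simp add: mor_mor[OF N])
  have twice: "?\<phi> (a + s) (?\<phi> a x) = mor N a (a + 2 * s) x" if "x \<in> carrier (obj N a)" for a x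
    using mor_mor[OF N _ _ that, of "a + s" "a + s + s"] s by (simp add: algebra_simps)
  have "?\<phi> a \<in> linear_maps K (obj ?M a) (obj N (a + s))" for a
    using linear_maps_restrict_carriers[OF linear sub, of a "carrier (obj N (a + s))"]
      sub[of a] mor_closed[OF N, of a "a + s"] s
    by (auto simp: past_image_def image_subset_iff)
  then have "shift_morphism K s ?M N ?\<phi>"
    using natural carrier unfolding shift_morphism_def mor by blast
  moreover have "?\<phi> a \<in> linear_maps K (obj N a) (obj ?M (a + s))" for a
    using linear_maps_restrict_carriers[OF linear, of "carrier (obj N a)" a]
    by (simp add: past_image_def)
  then have "shift_morphism K s N ?M ?\<phi>"
    using natural unfolding shift_morphism_def mor by blast
  ultimately show ?thesis
    using s twice carrier unfolding interleaved_def mor by blast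
qed

theorem corollary3p21:
  fixes K :: "('k, 'r) ring_scheme"
  assumes "field K"
  shows "enveloping_distance K (pfd K :: ('k, 'v) persistence_data set) (qtame K) = 0"
proof -
  have "\<exists>M \<in> pfd K. interleaved K s M N" if "N \<in> qtame K" "0 < s"
    for s and N :: "('k, 'v) persistence_data"
    using past_image_in_pfd[OF that] interleaved_past_image[of K N s] that
    by (auto simp: qtame_def)
  then show ?thesis
    unfolding enveloping_distance_def
    by (intro antisym Inf_lower Inf_greatest) (auto simp: zero_ereal_def)
qed

end
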